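(* For every $\gamma\in[0,1/2]$ and every instance of MP-KHD, $\mathbb{E}[\text{profit of }\mathsf{ATT}(\gamma)]\ge\gamma\cdot\mathrm{OPT\text{-}OFF}$; i.e., $\mathsf{ATT}(\gamma)$ achieves competitive ratio $\gamma$.
   Context: An instance of MP-KHD consists of: a bipartite graph $G=(I,J,E)$ with finite sets $I$ (offline agent types) and $J$ (online agent types); a finite set of prices $\{a_1,\dots,a_K\}$; a capacity $b_i\in\mathbb{Z}_{>0}$ for each $i\in I$; a horizon $T\in\mathbb{Z}_{>0}$; for each $t\in[T]$ a probability distribution $(q_{j,t})_{j\in J}$ on $J$; the assignment set $\mathcal{F}=\{(i,j,k):(i,j)\in E,k\in[K]\}$; for each $f\in\mathcal{F}$, $t\in[T]$, an acceptance probability $p_{f,t}\in(0,1]$ and profit $w_{f,t}\ge0$. $\mathcal{F}_j$ ($\mathcal{F}_i$) is the set of assignments with second (first) coordinate $j$ ($i$). The instance is known in advance. In each round $t$, an online agent type $\hat j_t$ arrives, independently across rounds, with $\Pr[\hat j_t=j]=q_{j,t}$; the policy irrevocably rejects it or selects one $f=(i,\hat j_t,k)\in\mathcal{F}_{\hat j_t}$ with $i$ having remaining capacity; the agent independently accepts with probability $p_{f,t}$ (then $i$'s capacity drops by one and profit $w_{f,t}$ is earned), else nothing happens. $\mathrm{OPT\text{-}OFF}$ is the maximum expected total profit of a clairvoyant policy that observes the whole arrival sequence before deciding. Policy $\mathsf{ATT}(\gamma)$, $\gamma\in[0,1/2]$: replace each offline type $i$ by $b_i$ copies of capacity 1 (inheriting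 $i$'s edges, probabilities and profits), and work with this unit-capacity instance. Solve the LP $\max\sum_{t,f}x_{f,t}p_{f,t}w_{f,t}$ s.t. $\sum_{f\in\mathcal{F}_j}x_{f,t}\le q_{j,t}$ for all $j,t$; $\sum_t\sum_{f\in\mathcal{F}_i}x_{f,t}p_{f,t}\le1$ for all $i$; $x\ge0$; let $x$ be an optimal solution. Set $\beta_{i,t}=1-\gamma\sum_{t'<t}\sum_{f\in\mathcal{F}_i}x_{f,t'}p_{f,t'}$. In round $t$, when $j$ arrives, sample at most one assignment, choosing each $f=(i,j,k)\in\mathcal{F}_j$ with probability $\frac{x_{f,t}}{q_{j,t}}\cdot\frac{\gamma}{\beta_{i,t}}$; if some $f=(i,j,k)$ is sampled and $i$ still has its unit of capacity, select $f$; otherwise reject. *)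

theory Defs
  imports "HOL-Probability.Probability"
begin

text \<open>
  Rounds are numbered \<open>1, \<dots>, T\<close> and prices are indexed by \<open>1, \<dots>, K\<close>. The probability
  \<open>q\<^sub>j\<^sub>,\<^sub>t\<close> that the type \<open>j\<close> arrives in round \<open>t\<close> is \<open>pmf (arrival M t) j\<close>.
\<close>

type_synonym ('i, 'j) assignment = "'i \<times> 'j \<times> nat"

record ('i, 'j) mpkhd =
  offline :: "'i set"
  online :: "'j set"
  edges :: "('i \<times> 'j) set"
  num_prices :: nat
  price :: "nat \<Rightarrow> real"
  capacity :: "'i \<Rightarrow> nat"
  horizon :: nat
  arrival :: "nat \<Rightarrow> 'j pmf"
  accept :: "('i, 'j) assignment \<Rightarrow> nat \<Rightarrow> real"
  profit :: "('i, 'j) assignment \<Rightarrow> nat \<Rightarrow> real"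

definition rounds :: "('i, 'j) mpkhd \<Rightarrow> nat set" where
  "rounds M = {1..horizon M}"

definition assignments :: "('i, 'j) mpkhd \<Rightarrow> ('i, 'j) assignment set" where
  "assignments M = {(i, j, k). (i, j) \<in> edges M \<and> k \<in> {1..num_prices M}}"

definition assignments_on :: "('i, 'j) mpkhd \<Rightarrow> 'j \<Rightarrow> ('i, 'j) assignment set" where
  "assignments_on M j = {f \<in> assignments M. fst (snd f) = j}"

definition assignments_off :: "('i, 'j) mpkhd \<Rightarrow> 'i \<Rightarrow> ('i, 'j) assignment set" where
  "assignments_off M i = {f \<in> assignments M. fst f = i}"

definition mpkhd_instance :: "('i, 'j) mpkhd \<Rightarrow> bool" where
  "mpkhd_instance M \<longleftrightarrow>
     finite (offline M) \<and> finite (online M) \<and>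
     edges M \<subseteq> offline M \<times> online M \<and>
     inj_on (price M) {1..num_prices M} \<and>
     (\<forall>i\<in>offline M. 0 < capacity M i) \<and>
     0 < horizon M \<and>
     (\<forall>t\<in>rounds M. set_pmf (arrival M t) \<subseteq> online M) \<and>
     (\<forall>f\<in>assignments M. \<forall>t\<in>rounds M. 0 < accept M f t \<and> accept M f t \<le> 1) \<and>
     (\<forall>f\<in>assignments M. \<forall>t\<in>rounds M. 0 \<le> profit M f t)"


section \<open>Policies and their expected profit\<close>

text \<open>
  The \<open>n\<close>-th entry of a history (counting from \<open>0\<close>) is the outcome of round \<open>n + 1\<close>: the selected
  assignment (\<open>None\<close> is rejection) and whether the online agent accepted it.
\<close>

type_synonym ('i, 'j) history = "(('i, 'j) assignment option \<times> bool) list"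

definition used :: "('i, 'j) history \<Rightarrow> 'i \<Rightarrow> nat" where
  "used h i = card {n. n < length h \<and> (\<exists>j k. h ! n = (Some (i, j, k), True))}"

definition available :: "('i, 'j) mpkhd \<Rightarrow> ('i, 'j) history \<Rightarrow> 'i \<Rightarrow> bool" where
  "available M h i \<longleftrightarrow> used h i < capacity M i"

definition total_profit :: "('i, 'j) mpkhd \<Rightarrow> ('i, 'j) history \<Rightarrow> real" where
  "total_profit M h =
     (\<Sum>n<length h. case h ! n of (Some f, True) \<Rightarrow> profit M f (Suc n) | _ \<Rightarrow> 0)"

text \<open>
  A policy maps an arrival sequence \<open>a\<close> (\<open>a t\<close> is the type arriving in round \<open>t\<close>) and the history
  \<open>h\<close> of the completed rounds to a possibly randomised decision for round \<open>length h + 1\<close>.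
  A clairvoyant policy may inspect all of \<open>a\<close>; it still learns an acceptance only after having
  selected an assignment. An online policy inspects \<open>a\<close> only up to the current round.
\<close>

type_synonym ('i, 'j) policy =
  "(nat \<Rightarrow> 'j) \<Rightarrow> ('i, 'j) history \<Rightarrow> ('i, 'j) assignment option pmf"

definition clairvoyant_policy :: "('i, 'j) mpkhd \<Rightarrow> ('i, 'j) policy \<Rightarrow> bool" where
  "clairvoyant_policy M \<pi> \<longleftrightarrow>
     (\<forall>a h f. length h < horizon M \<longrightarrow> Some f \<in> set_pmf (\<pi> a h) \<longrightarrow>
        f \<in> assignments_on M (a (Suc (length h))) \<and> available M h (fst f))"

definition response :: "('i, 'j) mpkhd \<Rightarrow> nat \<Rightarrow> ('i, 'j) assignment option \<Rightarrow> bool pmf" where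
  "response M t s = (case s of None \<Rightarrow> return_pmf False | Some f \<Rightarrow> bernoulli_pmf (accept M f t))"

primrec run :: "('i, 'j) mpkhd \<Rightarrow> ('i, 'j) policy \<Rightarrow> (nat \<Rightarrow> 'j) \<Rightarrow> nat \<Rightarrow> ('i, 'j) history pmf" where
  "run M \<pi> a 0 = return_pmf []"
| "run M \<pi> a (Suc t) = do {
     h \<leftarrow> run M \<pi> a t;
     s \<leftarrow> \<pi> a h;
     r \<leftarrow> response M (Suc t) s;
     return_pmf (h @ [(s, r)])
   }"

text \<open>Independence of the arrivals across rounds is expressed by the product distribution.\<close>

definition arrivals :: "('i, 'j) mpkhd \<Rightarrow> (nat \<Rightarrow> 'j) pmf" where
  "arrivals M = Pi_pmf (rounds M) undefined (arrival M)"

definition expected_profit :: "('i, 'j) mpkhd \<Rightarrow> ('i, 'j) policy \<Rightarrow> real" where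
  "expected_profit M \<pi> =
     measure_pmf.expectation
       (do { a \<leftarrow> arrivals M; run M \<pi> a (horizon M) })
       (total_profit M)"

text \<open>
  For an instance, the set below is nonempty (always reject) and bounded above (by the sum of all
  profits), so the supremum is not a junk value.
\<close>

definition opt_off :: "('i, 'j) mpkhd \<Rightarrow> real" where
  "opt_off M = Sup {expected_profit M \<pi> | \<pi>. clairvoyant_policy M \<pi>}"


section \<open>The policy ATT\<close>

definition unit_split :: "('i, 'j) mpkhd \<Rightarrow> ('i \<times> nat, 'j) mpkhd" where
  "unit_split M = \<lparr>
     offline = {(i, c). i \<in> offline M \<and> c \<in> {1..capacity M i}},
     online = online M,
     edges = {((i, c), j). (i, j) \<in> edges M \<and> c \<in> {1..capacity M i}},
     num_prices = num_prices M,
     price = price M,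
     capacity = (\<lambda>_. 1),
     horizon = horizon M,
     arrival = arrival M,
     accept = (\<lambda>((i, c), j, k). accept M (i, j, k)),
     profit = (\<lambda>((i, c), j, k). profit M (i, j, k)) \<rparr>"

text \<open>The LP is stated for unit-capacity instances; \<open>x f t\<close> is the variable \<open>x\<^sub>f\<^sub>,\<^sub>t\<close>.\<close>

type_synonym ('i, 'j) lp_vector = "('i, 'j) assignment \<Rightarrow> nat \<Rightarrow> real"

definition lp_value :: "('i, 'j) mpkhd \<Rightarrow> ('i, 'j) lp_vector \<Rightarrow> real" where
  "lp_value M x = (\<Sum>t\<in>rounds M. \<Sum>f\<in>assignments M. x f t * accept M f t * profit M f t)"

definition lp_feasible :: "('i, 'j) mpkhd \<Rightarrow> ('i, 'j) lp_vector \<Rightarrow> bool" where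
  "lp_feasible M x \<longleftrightarrow>
     (\<forall>t\<in>rounds M. \<forall>j\<in>online M. (\<Sum>f\<in>assignments_on M j. x f t) \<le> pmf (arrival M t) j) \<and>
     (\<forall>i\<in>offline M. (\<Sum>t\<in>rounds M. \<Sum>f\<in>assignments_off M i. x f t * accept M f t) \<le> 1) \<and>
     (\<forall>t\<in>rounds M. \<forall>f\<in>assignments M. 0 \<le> x f t)"

definition lp_optimal :: "('i, 'j) mpkhd \<Rightarrow> ('i, 'j) lp_vector \<Rightarrow> bool" where
  "lp_optimal M x \<longleftrightarrow> lp_feasible M x \<and> (\<forall>y. lp_feasible M y \<longrightarrow> lp_value M y \<le> lp_value M x)"

definition att_beta :: "('i, 'j) mpkhd \<Rightarrow> real \<Rightarrow> ('i, 'j) lp_vector \<Rightarrow> 'i \<Rightarrow> nat \<Rightarrow> real" where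
  "att_beta M \<gamma> x i t =
     1 - \<gamma> * (\<Sum>t'\<in>{1..<t}. \<Sum>f\<in>assignments_off M i. x f t' * accept M f t')"

definition att_prob ::
    "('i, 'j) mpkhd \<Rightarrow> real \<Rightarrow> ('i, 'j) lp_vector \<Rightarrow> nat \<Rightarrow> 'j \<Rightarrow> ('i, 'j) assignment \<Rightarrow> real" where
  "att_prob M \<gamma> x t j f = x f t / pmf (arrival M t) j * (\<gamma> / att_beta M \<gamma> x (fst f) t)"

definition att_sample ::
    "('i, 'j) mpkhd \<Rightarrow> real \<Rightarrow> ('i, 'j) lp_vector \<Rightarrow> nat \<Rightarrow> 'j \<Rightarrow> ('i, 'j) assignment option pmf" where
  "att_sample M \<gamma> x t j = embed_pmf (\<lambda>s. case s of
       None \<Rightarrow> 1 - (\<Sum>f\<in>assignments_on M j. att_prob M \<gamma> x t j f)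
     | Some f \<Rightarrow> if f \<in> assignments_on M j then att_prob M \<gamma> x t j f else 0)"

definition att :: "('i, 'j) mpkhd \<Rightarrow> real \<Rightarrow> ('i, 'j) lp_vector \<Rightarrow> ('i, 'j) policy" where
  "att M \<gamma> x a h =
     map_pmf
       (\<lambda>s. case s of None \<Rightarrow> None | Some f \<Rightarrow> if available M h (fst f) then Some f else None)
       (att_sample M \<gamma> x (Suc (length h)) (a (Suc (length h))))"


section \<open>Well-definedness of ATT\<close>

text \<open>
  \<open>embed_pmf\<close> is only meaningful if the given weights form a distribution; \<open>pmf_att_sample\<close> confirms
  this, and \<open>lp_optimal_exists\<close> that there always is an optimal LP solution. A type \<open>j\<close> with
  arrival probability \<open>0\<close> gives all weights \<open>x / 0 = 0\<close>.
\<close>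

lemma finite_assignments: "mpkhd_instance M \<Longrightarrow> finite (assignments M)"
  unfolding mpkhd_instance_def assignments_def
  by (rule finite_subset[of _ "offline M \<times> online M \<times> {1..num_prices M}"]) auto

lemma mpkhd_instance_unit_split:
  assumes "mpkhd_instance M"
  shows "mpkhd_instance (unit_split M)"
proof -
  have "offline (unit_split M) = (SIGMA i:offline M. {1..capacity M i})"
    by (auto simp: unit_split_def)
  then have "finite (offline (unit_split M))"
    using assms by (auto simp: mpkhd_instance_def)
  moreover have "accept (unit_split M) f t = accept M (fst (fst f), snd f) t"
    and "profit (unit_split M) f t = profit M (fst (fst f), snd f) t" for f t
    by (simp_all add: unit_split_def split: prod.splits)
  moreover have "(fst (fst f), snd f) \<in> assignments M" if "f \<in> assignments (unit_split M)" for f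
    using that by (auto simp: assignments_def unit_split_def)
  moreover have "edges (unit_split M) \<subseteq> offline (unit_split M) \<times> online M"
    using assms by (auto simp: mpkhd_instance_def unit_split_def)
  moreover have "rounds (unit_split M) = rounds M" "online (unit_split M) = online M"
    "arrival (unit_split M) = arrival M" "price (unit_split M) = price M"
    "num_prices (unit_split M) = num_prices M" "horizon (unit_split M) = horizon M"
    "capacity (unit_split M) = (\<lambda>_. 1)"
    by (simp_all add: rounds_def unit_split_def)
  ultimately show ?thesis
    using assms unfolding mpkhd_instance_def by simp
qed

lemma assignments_on_finite: "mpkhd_instance M \<Longrightarrow> finite (assignments_on M j)"
  using finite_assignments[of M] by (auto simp: assignments_on_def)

lemma assignments_off_finite: "mpkhd_instance M \<Longrightarrow> finite (assignments_off M i)"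
  using finite_assignments[of M] by (auto simp: assignments_off_def)

lemma att_beta_ge:
  assumes M: "mpkhd_instance M" and x: "lp_feasible M x" and g: "0 \<le> \<gamma>"
    and t: "t \<in> rounds M" and i: "i \<in> offline M"
  shows "1 - \<gamma> \<le> att_beta M \<gamma> x i t"
proof -
  have nn: "0 \<le> x f s * accept M f s" if "s \<in> rounds M" "f \<in> assignments_off M i" for s f
  proof (rule mult_nonneg_nonneg)
    have "f \<in> assignments M" using that by (simp add: assignments_off_def)
    then show "0 \<le> x f s" "0 \<le> accept M f s"
      using that M x by (simp_all add: mpkhd_instance_def lp_feasible_def less_imp_le)
  qed
  have "(\<Sum>t'\<in>{1..<t}. \<Sum>f\<in>assignments_off M i. x f t' * accept M f t')
      \<le> (\<Sum>t'\<in>rounds M. \<Sum>f\<in>assignments_off M i. x f t' * accept M f t')"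
    using t nn by (intro sum_mono2 sum_nonneg) (auto simp: rounds_def)
  also have "\<dots> \<le> 1"
    using x i by (auto simp: lp_feasible_def)
  finally show ?thesis
    using g mult_left_le[of _ \<gamma>] unfolding att_beta_def by (intro diff_left_mono) blast
qed

lemma att_prob_bounds:
  assumes M: "mpkhd_instance M" and x: "lp_feasible M x" and g: "0 \<le> \<gamma>" "\<gamma> \<le> 1 / 2"
    and t: "t \<in> rounds M" and j: "j \<in> online M"
  shows "f \<in> assignments_on M j \<Longrightarrow> 0 \<le> att_prob M \<gamma> x t j f"
    and "(\<Sum>f\<in>assignments_on M j. att_prob M \<gamma> x t j f) \<le> 1"
proof -
  let ?q = "pmf (arrival M t) j"
  have *: "0 \<le> x f t / ?q \<and> 0 \<le> \<gamma> / att_beta M \<gamma> x (fst f) t \<and> \<gamma> / att_beta M \<gamma> x (fst f) t \<le> 1"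
    if f: "f \<in> assignments_on M j" for f
  proof -
    have "f \<in> assignments M" using f by (simp add: assignments_on_def)
    moreover then have "fst f \<in> offline M"
      using M by (auto simp: assignments_def mpkhd_instance_def)
    ultimately show ?thesis
      using att_beta_ge[OF M x g(1) t, of "fst f"] x t g by (auto simp: lp_feasible_def)
  qed
  show "f \<in> assignments_on M j \<Longrightarrow> 0 \<le> att_prob M \<gamma> x t j f"
    unfolding att_prob_def by (intro mult_nonneg_nonneg) (use * in blast)+
  have "(\<Sum>f\<in>assignments_on M j. att_prob M \<gamma> x t j f) \<le> (\<Sum>f\<in>assignments_on M j. x f t / ?q)"
    unfolding att_prob_def by (intro sum_mono mult_left_le) (use * in blast)+
  also have "\<dots> = (\<Sum>f\<in>assignments_on M j. x f t) / ?q"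
    by (simp add: sum_divide_distrib)
  also have "\<dots> \<le> 1"
    using x t j pmf_nonneg[of "arrival M t" j] by (cases "?q = 0") (auto simp: lp_feasible_def)
  finally show "(\<Sum>f\<in>assignments_on M j. att_prob M \<gamma> x t j f) \<le> 1" .
qed

lemma pmf_att_sample:
  assumes "mpkhd_instance M" "lp_feasible M x" "0 \<le> \<gamma>" "\<gamma> \<le> 1 / 2" "t \<in> rounds M" "j \<in> online M"
  shows "pmf (att_sample M \<gamma> x t j) (Some f) =
    (if f \<in> assignments_on M j then att_prob M \<gamma> x t j f else 0)"
proof -
  define F where "F = assignments_on M j"
  define r where "r = att_prob M \<gamma> x t j"
  define g where "g = (\<lambda>s. case s of None \<Rightarrow> 1 - sum r F | Some f \<Rightarrow> if f \<in> F then r f else 0)"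
  have fin: "finite F" using assms assignments_on_finite by (auto simp: F_def)
  have r: "f \<in> F \<Longrightarrow> 0 \<le> r f" "sum r F \<le> 1" for f
    using att_prob_bounds[OF assms] by (auto simp: F_def r_def)
  have g0: "0 \<le> g s" for s using r by (auto simp: g_def split: option.splits)
  have "(\<integral>\<^sup>+ s. ennreal (g s) \<partial>count_space UNIV) = (\<Sum>s\<in>insert None (Some ` F). ennreal (g s))"
    using fin by (intro nn_integral_count_space') (auto simp: g_def split: option.splits)
  also have "\<dots> = ennreal (\<Sum>s\<in>insert None (Some ` F). g s)"
    using g0 by (simp add: sum_ennreal)
  also have "(\<Sum>s\<in>insert None (Some ` F). g s) = 1"
    using fin by (simp add: sum.reindex g_def)
  finally have "pmf (embed_pmf g) (Some f) = g (Some f)"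
    using g0 by (intro pmf_embed_pmf) auto
  moreover have "att_sample M \<gamma> x t j = embed_pmf g"
    by (simp only: att_sample_def g_def F_def r_def)
  ultimately show ?thesis
    by (simp add: g_def F_def r_def)
qed

lemma lp_optimal_exists:
  assumes M: "mpkhd_instance M"
  shows "\<exists>x. lp_optimal M x"
proof -
  define D where "D = assignments M \<times> rounds M"
  define B where "B = (\<lambda>d. if d \<in> D then {0..1::real} else {0})"
  define C where "C = Pi UNIV B \<inter> {z. lp_feasible M (curry z)}"
  have fe: "lp_feasible M x \<longleftrightarrow> lp_feasible M y" and ve: "lp_value M x = lp_value M y"
    if "\<And>f t. f \<in> assignments M \<Longrightarrow> t \<in> rounds M \<Longrightarrow> x f t = y f t" for x y
    using that by (auto simp: lp_feasible_def lp_value_def assignments_on_def assignments_off_def)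
  have "compactin (product_topology (\<lambda>_. euclidean) UNIV) (PiE UNIV B)"
    by (subst compactin_PiE) (auto simp: B_def)
  then have "compact (Pi UNIV B)"
    by (simp add: euclidean_product_topology PiE_UNIV_domain)
  moreover have "closed {z. lp_feasible M (curry z)}"
    unfolding lp_feasible_def curry_def Ball_def
    by (intro closed_Collect_conj closed_Collect_all closed_Collect_imp closed_Collect_le
        open_Collect_const continuous_intros continuous_on_product_coordinates)
  ultimately have "compact C" unfolding C_def by (rule compact_Int_closed)
  moreover have "(\<lambda>_. 0) \<in> C"
    by (auto simp: C_def B_def lp_feasible_def curry_def)
  then have "C \<noteq> {}" by blast
  moreover have "continuous_on C (\<lambda>z. lp_value M (curry z))"
    unfolding lp_value_def curry_def
    by (intro continuous_intros continuous_on_subset[OF continuous_on_product_coordinates]) auto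
  ultimately obtain z where z: "z \<in> C" "\<And>y. y \<in> C \<Longrightarrow> lp_value M (curry y) \<le> lp_value M (curry z)"
    using continuous_attains_sup[of C "\<lambda>z. lp_value M (curry z)"] by blast
  have "lp_value M y \<le> lp_value M (curry z)" if y: "lp_feasible M y" for y
  proof -
    define w where "w = (\<lambda>(f, t). if (f, t) \<in> D then y f t else 0)"
    have wy: "curry w f t = y f t" if "f \<in> assignments M" "t \<in> rounds M" for f t
      using that by (simp add: w_def D_def)
    have "y f t \<le> 1" if "f \<in> assignments M" "t \<in> rounds M" for f t
    proof -
      let ?j = "fst (snd f)"
      have j: "?j \<in> online M" using that M by (auto simp: assignments_def mpkhd_instance_def)
      have "y f t \<le> (\<Sum>f\<in>assignments_on M ?j. y f t)"
        using that y assignments_on_finite[OF M]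
        by (intro member_le_sum) (auto simp: assignments_on_def lp_feasible_def)
      also have "\<dots> \<le> pmf (arrival M t) ?j" using that y j by (auto simp: lp_feasible_def)
      also have "\<dots> \<le> 1" by (rule pmf_le_1)
      finally show ?thesis .
    qed
    moreover have "lp_feasible M (curry w)" using y fe[of "curry w" y] wy by blast
    ultimately have "w \<in> C"
      using y by (auto simp: C_def B_def w_def D_def lp_feasible_def)
    then show ?thesis using z(2)[of w] ve[of "curry w" y] wy by simp
  qed
  moreover have "lp_feasible M (curry z)" using z(1) by (simp add: C_def)
  ultimately show ?thesis unfolding lp_optimal_def by blast
qed
end

theory Submission imports Defs begin

section \<open>Expectations over finitely supported distributions\<close>

text \<open>Profit is linear in the probabilities that \<open>f\<close> is selected in round
  \<open>t\<close>, since acceptance is an independent coin flip after the selection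
  (\<open>expected_profit_eq\<close>). Both halves of the argument compare these probabilities with
  the LP on the instance split into unit-capacity copies.

  Upper bound on the benchmark: for a clairvoyant policy, spread the probabilities evenly over the
  copies of each type. At most one assignment is selected per round, and only for the type that
  arrives, which gives the arrival constraints; no run consumes more than the capacity, which gives
  the capacity constraints. So the policy's profit is the value of a feasible LP point
  (\<open>clairvoyant_lp_solution\<close>), and \<open>opt_off\<close> is at most the LP optimum
  (\<open>opt_off_le_lp_value\<close>).

  Profit of ATT: every \<open>f\<close> is selected in round \<open>t\<close> with probability
  exactly \<gamma> \<open>x f t\<close> (\<open>expectation_select_prob_att\<close>). By induction
  on \<open>t\<close>, the expected consumption of \<open>i\<close> before round \<open>t\<close> is
  \<gamma> times its LP consumption, so the unit of \<open>i\<close> is still there with probability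
  \<open>att_beta\<close>. This event depends on past rounds only, hence is independent of the
  current arrival, and the factor \<gamma> / \<open>att_beta\<close> in the sampling weight cancels
  it. From \<gamma> \<le> 1/2 follows \<open>att_beta\<close> \<ge> 1/2 \<ge> \<gamma>, so the
  weights form a distribution. The profit is thus \<gamma> times the LP optimum.\<close>

lemma expectation_bind_pmf:
  fixes h :: "'b \<Rightarrow> real"
  assumes "finite (set_pmf p)" and "\<And>x. x \<in> set_pmf p \<Longrightarrow> finite (set_pmf (f x))"
  shows "measure_pmf.expectation (p \<bind> f) h =
    measure_pmf.expectation p (\<lambda>x. measure_pmf.expectation (f x) h)"
  using assms by (subst pmf_expectation_bind[of "set_pmf p"])
    (auto simp: integral_measure_pmf[of "set_pmf p"])

lemma expectation_cong_pmf:
  fixes f g :: "'a \<Rightarrow> real"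
  assumes "\<And>x. x \<in> set_pmf p \<Longrightarrow> f x = g x"
  shows "measure_pmf.expectation p f = measure_pmf.expectation p g"
  using assms by (intro integral_cong_AE) (auto simp: AE_measure_pmf_iff)

lemma expectation_mono_pmf:
  fixes f g :: "'a \<Rightarrow> real"
  assumes "finite (set_pmf p)" and "\<And>x. x \<in> set_pmf p \<Longrightarrow> f x \<le> g x"
  shows "measure_pmf.expectation p f \<le> measure_pmf.expectation p g"
  using assms by (intro integral_mono_AE integrable_measure_pmf_finite)
    (auto simp: AE_measure_pmf_iff)

lemma expectation_sum_pmf:
  fixes f :: "'a \<Rightarrow> 'b \<Rightarrow> real"
  assumes "finite (set_pmf p)"
  shows "measure_pmf.expectation p (\<lambda>x. \<Sum>i\<in>I. f i x) = (\<Sum>i\<in>I. measure_pmf.expectation p (f i))"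
  using assms by (intro Bochner_Integration.integral_sum integrable_measure_pmf_finite)

text \<open>Independence of the coordinates: that \<open>g\<close> ignores coordinate
  \<open>k\<close> is expressed by invariance under updates there, so this coordinate can be drawn
  separately from the others.\<close>

lemma expectation_Pi_pmf_mult:
  fixes g h :: "_ \<Rightarrow> real"
  assumes A: "finite A" "k \<in> A" and fin: "\<And>x. x \<in> A \<Longrightarrow> finite (set_pmf (p x))"
    and g: "\<And>a y. g (a(k := y)) = g a"
  shows "measure_pmf.expectation (Pi_pmf A d p) (\<lambda>a. g a * h (a k)) =
    measure_pmf.expectation (Pi_pmf A d p) g * measure_pmf.expectation (p k) h"
proof -
  define P where "P = Pi_pmf (A - {k}) d p"
  have P: "Pi_pmf A d p = do {y \<leftarrow> p k; a \<leftarrow> P; return_pmf (a(k := y))}"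
    using Pi_pmf_insert'[of "A - {k}" k d p] A by (simp add: insert_absorb P_def)
  have finP: "finite (set_pmf P)"
    using A fin by (auto simp: P_def set_Pi_pmf)
  have "measure_pmf.expectation (Pi_pmf A d p) (\<lambda>a. g a * u (a k)) =
      measure_pmf.expectation P g * measure_pmf.expectation (p k) u" for u
    using A fin finP g unfolding P by (simp add: expectation_bind_pmf)
  \<comment> \<open>The constant function 1 identifies the expectation of \<open>g\<close> under
    \<open>P\<close> with the one under the full product.\<close>
  from this[of h] this[of "\<lambda>_. 1"] show ?thesis by simp
qed

section \<open>Profit and capacity usage of an admissible policy\<close>

text \<open>An arbitrary value \<open>v\<close> in place of the profit lets one expectation formula
  cover both the profit and the consumption of a type, the latter with an indicator as
  \<open>v\<close>.\<close>

definition accumulated ::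
    "(('i, 'j) assignment \<Rightarrow> nat \<Rightarrow> real) \<Rightarrow> ('i, 'j) history \<Rightarrow> real" where
  "accumulated v h = (\<Sum>n<length h. case h ! n of (Some f, True) \<Rightarrow> v f (Suc n) | _ \<Rightarrow> 0)"

text \<open>The common ground of clairvoyant policies and ATT. It speaks of a single arrival
  sequence because for ATT it is established on the support of \<open>arrivals\<close>.\<close>

definition admissible :: "('i, 'j) mpkhd \<Rightarrow> ('i, 'j) policy \<Rightarrow> (nat \<Rightarrow> 'j) \<Rightarrow> bool" where
  "admissible M \<pi> a \<longleftrightarrow>
     (\<forall>h f. length h < horizon M \<longrightarrow> Some f \<in> set_pmf (\<pi> a h) \<longrightarrow>
        f \<in> assignments M \<and> available M h (fst f))"

text \<open>Here \<open>t\<close> counts completed rounds, so the selection takes place in round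
  \<open>Suc t\<close>; the arrival sequence is held fixed.\<close>

definition select_prob ::
    "('i, 'j) mpkhd \<Rightarrow> ('i, 'j) policy \<Rightarrow> (nat \<Rightarrow> 'j) \<Rightarrow> nat \<Rightarrow> ('i, 'j) assignment \<Rightarrow> real" where
  "select_prob M \<pi> a t f = measure_pmf.expectation (run M \<pi> a t) (\<lambda>h. pmf (\<pi> a h) (Some f))"

lemma total_profit_eq_accumulated: "total_profit M = accumulated (profit M)"
  by (simp add: fun_eq_iff total_profit_def accumulated_def)

lemma accumulated_snoc:
  "accumulated v (h @ [(s, r)]) = accumulated v h +
     (case (s, r) of (Some f, True) \<Rightarrow> v f (Suc (length h)) | _ \<Rightarrow> 0)"
  by (simp add: accumulated_def nth_append)

lemma used_eq_accumulated:
  "real (used h i) = accumulated (\<lambda>f _. of_bool (fst f = i)) h"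
proof -
  have "accumulated (\<lambda>f _. of_bool (fst f = i)) h =
      (\<Sum>n<length h. of_bool (\<exists>j k. h ! n = (Some (i, j, k), True)))"
    unfolding accumulated_def
    by (intro sum.cong refl) (auto split: option.splits bool.splits prod.splits)
  also have "\<dots> = real (card ({..<length h} \<inter> {n. \<exists>j k. h ! n = (Some (i, j, k), True)}))"
    by (simp add: sum.If_cases of_bool_def)
  also have "{..<length h} \<inter> {n. \<exists>j k. h ! n = (Some (i, j, k), True)} =
      {n. n < length h \<and> (\<exists>j k. h ! n = (Some (i, j, k), True))}"
    by auto
  finally show ?thesis by (simp add: used_def)
qed

lemma set_pmf_admissible:
  assumes "admissible M \<pi> a" and "length h < horizon M"
  shows "set_pmf (\<pi> a h) \<subseteq> insert None (Some ` assignments M)"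
proof
  fix s assume "s \<in> set_pmf (\<pi> a h)"
  then show "s \<in> insert None (Some ` assignments M)"
    using assms by (cases s) (auto simp: admissible_def)
qed

lemma length_run: "h \<in> set_pmf (run M \<pi> a t) \<Longrightarrow> length h = t"
  by (induction t arbitrary: h) auto

lemma finite_set_pmf_admissible:
  assumes "mpkhd_instance M" and "admissible M \<pi> a" and "length h < horizon M"
  shows "finite (set_pmf (\<pi> a h))"
  using finite_subset[OF set_pmf_admissible[OF assms(2,3)]] finite_assignments[OF assms(1)] by simp

lemma finite_set_pmf_run:
  assumes "mpkhd_instance M" and "admissible M \<pi> a" and "t \<le> horizon M"
  shows "finite (set_pmf (run M \<pi> a t))"
  using assms(3)
proof (induction t)
  case (Suc t)
  then show ?case
    using length_run[of _ M \<pi> a t] finite_set_pmf_admissible[OF assms(1,2)]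
    by (auto simp: Suc_le_eq)
qed simp

lemma used_le_capacity:
  assumes "admissible M \<pi> a" and "t \<le> horizon M" and "h \<in> set_pmf (run M \<pi> a t)"
  shows "used h i \<le> capacity M i"
  using assms(2,3)
proof (induction t arbitrary: h)
  case (Suc t)
  then obtain h' s r where h: "h = h' @ [(s, r)]" "h' \<in> set_pmf (run M \<pi> a t)"
    "s \<in> set_pmf (\<pi> a h')"
    by auto
  then have "length h' < horizon M" using Suc.prems length_run by fastforce
  then have "used h' i < capacity M i" if "s = Some f" "fst f = i" for f
    using h(3) that assms(1) unfolding admissible_def available_def by blast
  moreover have "used h' i \<le> capacity M i" using Suc h by auto
  moreover have "real (used h i) = real (used h' i) +
      (case (s, r) of (Some f, True) \<Rightarrow> of_bool (fst f = i) | _ \<Rightarrow> 0)"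
    by (simp add: used_eq_accumulated h(1) accumulated_snoc)
  ultimately show ?case
    by (cases s; cases r) (auto simp: of_bool_def split: if_splits)
qed (simp add: used_def)

text \<open>Linearity of expectation over rounds: given the history, a selected \<open>f\<close> is
  accepted with probability \<open>accept M f (Suc s)\<close>, whatever happened before.\<close>

lemma expectation_accumulated:
  assumes M: "mpkhd_instance M" and adm: "admissible M \<pi> a" and "t \<le> horizon M"
  shows "measure_pmf.expectation (run M \<pi> a t) (accumulated v) =
    (\<Sum>s<t. \<Sum>f\<in>assignments M. select_prob M \<pi> a s f * accept M f (Suc s) * v f (Suc s))"
  using assms(3)
proof (induction t)
  case 0
  then show ?case by (simp add: accumulated_def)
next
  case (Suc t)
  define F where "F = assignments M"
  define R where "R = run M \<pi> a t"
  have finF: "finite F" using finite_assignments[OF M] by (simp add: F_def)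
  have finR: "finite (set_pmf R)" using finite_set_pmf_run[OF M adm] Suc.prems by (simp add: R_def)
  have acc: "0 \<le> accept M f (Suc t)" "accept M f (Suc t) \<le> 1" if "f \<in> F" for f
    using M that Suc.prems by (auto simp: mpkhd_instance_def rounds_def F_def less_imp_le)
  have step: "measure_pmf.expectation
        (\<pi> a h \<bind> (\<lambda>s. response M (Suc t) s \<bind> (\<lambda>r. return_pmf (h @ [(s, r)])))) (accumulated v) =
      accumulated v h + (\<Sum>f\<in>F. pmf (\<pi> a h) (Some f) * accept M f (Suc t) * v f (Suc t))"
    (is "?L = _") if h: "h \<in> set_pmf R" for h
  proof -
    \<comment> \<open>The expected gain of the current round once the decision \<open>s\<close> is
      made, averaged over the acceptance coin only.\<close>
    define e where "e = (\<lambda>s. case s of None \<Rightarrow> 0 | Some f \<Rightarrow> accept M f (Suc t) * v f (Suc t))"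
    have len: "length h = t" "length h < horizon M"
      using length_run[OF h[unfolded R_def]] Suc.prems by simp_all
    have sub: "set_pmf (\<pi> a h) \<subseteq> insert None (Some ` F)"
      using set_pmf_admissible[OF adm len(2)] by (simp add: F_def)
    have fin: "finite (set_pmf (\<pi> a h))" using sub finF finite_subset by blast
    have inner: "measure_pmf.expectation
        (response M (Suc t) s \<bind> (\<lambda>r. return_pmf (h @ [(s, r)]))) (accumulated v) =
        accumulated v h + e s" if "s \<in> set_pmf (\<pi> a h)" for s
    proof (cases s)
      case None
      then show ?thesis
        by (simp add: response_def bind_return_pmf accumulated_snoc e_def)
    next
      case (Some f)
      then have "f \<in> F" using that sub by auto
      then show ?thesis
        using Some acc[of f] len
        by (simp add: response_def expectation_bind_pmf accumulated_snoc e_def algebra_simps)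
    qed
    have "?L = measure_pmf.expectation (\<pi> a h) (\<lambda>s. accumulated v h + e s)"
      using fin by (subst expectation_bind_pmf) (auto intro!: expectation_cong_pmf inner)
    also have "\<dots> = accumulated v h + measure_pmf.expectation (\<pi> a h) e"
      using fin by (subst Bochner_Integration.integral_add)
        (auto intro: integrable_measure_pmf_finite)
    also have "measure_pmf.expectation (\<pi> a h) e = (\<Sum>s\<in>insert None (Some ` F). pmf (\<pi> a h) s * e s)"
      using finF sub by (subst integral_measure_pmf[of "insert None (Some ` F)"]) auto
    also have "\<dots> = (\<Sum>f\<in>F. pmf (\<pi> a h) (Some f) * accept M f (Suc t) * v f (Suc t))"
      using finF by (simp add: sum.reindex e_def mult.assoc)
    finally show ?thesis .
  qed
  have fin': "finite (set_pmf (\<pi> a h \<bind> (\<lambda>s. response M (Suc t) s \<bind> (\<lambda>r. return_pmf (h @ [(s, r)])))))"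
    if "h \<in> set_pmf R" for h
    using that finite_set_pmf_admissible[OF M adm, of h] length_run[of h] Suc.prems
    by (auto simp: R_def)
  have "measure_pmf.expectation (run M \<pi> a (Suc t)) (accumulated v) =
      measure_pmf.expectation R (\<lambda>h. accumulated v h +
        (\<Sum>f\<in>F. pmf (\<pi> a h) (Some f) * accept M f (Suc t) * v f (Suc t)))"
    unfolding run.simps R_def[symmetric]
    by (subst expectation_bind_pmf[OF finR fin']) (auto intro!: expectation_cong_pmf step)
  also have "\<dots> = measure_pmf.expectation R (accumulated v) +
      (\<Sum>f\<in>F. select_prob M \<pi> a t f * accept M f (Suc t) * v f (Suc t))"
    using finR
    by (subst Bochner_Integration.integral_add)
      (auto intro: integrable_measure_pmf_finite simp: expectation_sum_pmf select_prob_def R_def)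
  finally show ?case using Suc by (simp add: R_def F_def)
qed

lemma expectation_used:
  assumes M: "mpkhd_instance M" and adm: "admissible M \<pi> a" and t: "t \<le> horizon M"
  shows "measure_pmf.expectation (run M \<pi> a t) (\<lambda>h. real (used h i)) =
    (\<Sum>s<t. \<Sum>f\<in>assignments_off M i. select_prob M \<pi> a s f * accept M f (Suc s))"
proof -
  have "(\<Sum>f\<in>assignments M. select_prob M \<pi> a s f * accept M f (Suc s) * of_bool (fst f = i)) =
      (\<Sum>f\<in>assignments_off M i. select_prob M \<pi> a s f * accept M f (Suc s))" for s
    unfolding assignments_off_def using finite_assignments[OF M]
    by (intro sum.mono_neutral_cong_right) auto
  then show ?thesis
    unfolding used_eq_accumulated expectation_accumulated[OF assms] by simp
qed

lemma select_prob_nonneg: "0 \<le> select_prob M \<pi> a t f"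
  unfolding select_prob_def by (simp add: integral_nonneg_AE)

section \<open>Averaging over the random arrivals\<close>

lemma finite_set_pmf_arrival:
  assumes "mpkhd_instance M" and "t \<in> rounds M"
  shows "finite (set_pmf (arrival M t))"
proof (rule finite_subset)
  show "set_pmf (arrival M t) \<subseteq> online M" "finite (online M)"
    using assms by (simp_all add: mpkhd_instance_def)
qed

lemma finite_set_pmf_arrivals:
  assumes "mpkhd_instance M"
  shows "finite (set_pmf (arrivals M))"
proof -
  have "finite (rounds M)" by (simp add: rounds_def)
  moreover from this have
    "finite (PiE_dflt (rounds M) undefined (set_pmf \<circ> arrival M))"
    by (rule finite_PiE_dflt) (simp add: finite_set_pmf_arrival[OF assms])
  ultimately show ?thesis
    by (simp only: arrivals_def set_Pi_pmf)
qed

lemma arrivals_in_online: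
  assumes "mpkhd_instance M" and "a \<in> set_pmf (arrivals M)" and "t \<in> rounds M"
  shows "a t \<in> online M"
proof -
  have "a t \<in> set_pmf (arrival M t)"
    using assms(2,3) by (auto simp: arrivals_def set_Pi_pmf PiE_dflt_def rounds_def)
  moreover have "set_pmf (arrival M t) \<subseteq> online M"
    using assms(1,3) by (simp add: mpkhd_instance_def)
  ultimately show ?thesis by blast
qed

lemma sum_rounds: "(\<Sum>t\<in>rounds M. g t) = (\<Sum>t<horizon M. g (Suc t))"
  by (simp add: rounds_def sum.atLeast1_atMost_eq)

text \<open>A policy enters its profit only through the averaged selection probabilities, which can
  therefore be read as LP variables.\<close>

lemma expected_profit_eq:
  assumes M: "mpkhd_instance M"
    and adm: "\<And>a. a \<in> set_pmf (arrivals M) \<Longrightarrow> admissible M \<pi> a"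
  shows "expected_profit M \<pi> = (\<Sum>t<horizon M. \<Sum>f\<in>assignments M.
    measure_pmf.expectation (arrivals M) (\<lambda>a. select_prob M \<pi> a t f) *
      accept M f (Suc t) * profit M f (Suc t))"
proof -
  note fin = finite_set_pmf_arrivals[OF M]
  have "expected_profit M \<pi> = measure_pmf.expectation (arrivals M)
      (\<lambda>a. \<Sum>t<horizon M. \<Sum>f\<in>assignments M.
        select_prob M \<pi> a t f * accept M f (Suc t) * profit M f (Suc t))"
    unfolding expected_profit_def total_profit_eq_accumulated
    by (subst expectation_bind_pmf)
      (auto intro!: fin expectation_cong_pmf expectation_accumulated finite_set_pmf_run M adm)
  also have "\<dots> = (\<Sum>t<horizon M. \<Sum>f\<in>assignments M.
    measure_pmf.expectation (arrivals M) (\<lambda>a. select_prob M \<pi> a t f) *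
      accept M f (Suc t) * profit M f (Suc t))"
    by (simp add: expectation_sum_pmf[OF fin])
  finally show ?thesis .
qed

section \<open>The LP bounds every clairvoyant policy\<close>

lemma expectation_arrival:
  assumes "t \<in> rounds M"
  shows "measure_pmf.expectation (arrivals M) (\<lambda>a. of_bool (a t = j)) = pmf (arrival M t) j"
proof -
  have "measure_pmf.expectation (arrivals M) (\<lambda>a. of_bool (a t = j)) =
      measure_pmf.expectation (map_pmf (\<lambda>a. a t) (arrivals M)) (\<lambda>y. of_bool (y = j) :: real)"
    by simp
  also have "map_pmf (\<lambda>a. a t) (arrivals M) = arrival M t"
    using assms by (simp add: arrivals_def Pi_pmf_component rounds_def)
  also have "measure_pmf.expectation (arrival M t) (\<lambda>y. of_bool (y = j)) = pmf (arrival M t) j"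
    by (subst integral_measure_pmf_real[of "{j}"]) auto
  finally show ?thesis .
qed

lemma clairvoyant_admissible: "clairvoyant_policy M \<pi> \<Longrightarrow> admissible M \<pi> a"
  unfolding clairvoyant_policy_def admissible_def assignments_on_def by blast

text \<open>The events of selecting different assignments in one round are disjoint, and none with
  second coordinate \<open>j\<close> can occur unless \<open>j\<close> arrives. With the sequence
  fixed, it is irrelevant how much of it the policy sees.\<close>

lemma sum_select_prob_le:
  assumes M: "mpkhd_instance M" and \<pi>: "clairvoyant_policy M \<pi>" and t: "t < horizon M"
  shows "(\<Sum>f\<in>assignments_on M j. select_prob M \<pi> a t f) \<le> of_bool (a (Suc t) = j)"
proof -
  let ?F = "assignments_on M j"
  have fin: "finite (set_pmf (run M \<pi> a t))"
    using finite_set_pmf_run[OF M clairvoyant_admissible[OF \<pi>]] t by simp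
  have "(\<Sum>f\<in>?F. pmf (\<pi> a h) (Some f)) \<le> of_bool (a (Suc t) = j)"
    if "h \<in> set_pmf (run M \<pi> a t)" for h
  proof (cases "a (Suc t) = j")
    case True
    have "(\<Sum>f\<in>?F. pmf (\<pi> a h) (Some f)) = (\<Sum>s\<in>Some ` ?F. pmf (\<pi> a h) s)"
      by (simp add: sum.reindex)
    also have "\<dots> = measure_pmf.prob (\<pi> a h) (Some ` ?F)"
      using assignments_on_finite[OF M] by (simp add: measure_measure_pmf_finite)
    finally show ?thesis using True by simp
  next
    case False
    have "Some f \<notin> set_pmf (\<pi> a h)" if "f \<in> ?F" for f
    proof
      assume "Some f \<in> set_pmf (\<pi> a h)"
      moreover have "length h = t" by (rule length_run[OF \<open>h \<in> _\<close>])
      ultimately have "f \<in> assignments_on M (a (Suc t))"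
        using \<pi> t unfolding clairvoyant_policy_def by blast
      then show False using that False by (simp add: assignments_on_def)
    qed
    then show ?thesis using False by (simp add: set_pmf_iff)
  qed
  then have "measure_pmf.expectation (run M \<pi> a t) (\<lambda>h. \<Sum>f\<in>?F. pmf (\<pi> a h) (Some f)) \<le>
      measure_pmf.expectation (run M \<pi> a t) (\<lambda>_. of_bool (a (Suc t) = j))"
    by (rule expectation_mono_pmf[OF fin])
  then show ?thesis by (simp add: expectation_sum_pmf[OF fin] select_prob_def)
qed

section \<open>Passing to unit-capacity copies\<close>

definition original :: "('i \<times> nat, 'j) assignment \<Rightarrow> ('i, 'j) assignment" where
  "original f = (fst (fst f), snd f)"

lemma unit_split_simps:
  "rounds (unit_split M) = rounds M" "online (unit_split M) = online M"
  "arrival (unit_split M) = arrival M" "capacity (unit_split M) = (\<lambda>_. 1)"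
  "accept (unit_split M) f t = accept M (original f) t"
  "profit (unit_split M) f t = profit M (original f) t"
  by (simp_all add: unit_split_def rounds_def original_def split: prod.splits)

lemma assignments_unit_split:
  "f \<in> assignments (unit_split M) \<longleftrightarrow>
     original f \<in> assignments M \<and> snd (fst f) \<in> {1..capacity M (fst (original f))}"
  by (auto simp: assignments_def unit_split_def original_def)

text \<open>The fibre of \<open>original\<close> over an assignment of type \<open>i\<close> has
  exactly \<open>capacity M i\<close> elements, so dividing by the capacity makes the copies add up
  to the original term.\<close>

lemma sum_unit_split:
  assumes M: "mpkhd_instance M"
  shows "(\<Sum>f | f \<in> assignments (unit_split M) \<and> P (original f).
      g (original f) / real (capacity M (fst (original f)))) =
    (\<Sum>f | f \<in> assignments M \<and> P f. g f)"
proof -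
  let ?A = "{f \<in> assignments (unit_split M). P (original f)}"
  let ?B = "{f \<in> assignments M. P f}"
  let ?g = "\<lambda>f. g (original f) / real (capacity M (fst (original f)))"
  have fib: "(\<Sum>f | f \<in> ?A \<and> original f = b. ?g f) = g b" if b: "b \<in> ?B" for b
  proof -
    have "{f. f \<in> ?A \<and> original f = b} = (\<lambda>c. ((fst b, c), snd b)) ` {1..capacity M (fst b)}"
      using b by (auto simp: assignments_unit_split original_def image_iff)
    moreover have "inj_on (\<lambda>c. ((fst b, c), snd b)) {1..capacity M (fst b)}"
      by (auto simp: inj_on_def)
    moreover have "fst b \<in> offline M"
      using b M by (auto simp: assignments_def mpkhd_instance_def)
    then have "0 < capacity M (fst b)" using M by (simp add: mpkhd_instance_def)
    ultimately show ?thesis by (simp add: sum.reindex original_def)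
  qed
  have "(\<Sum>f\<in>?A. ?g f) = (\<Sum>b\<in>?B. \<Sum>f | f \<in> ?A \<and> original f = b. ?g f)"
  proof (rule sum.group[symmetric])
    show "finite ?A" "finite ?B"
      using finite_assignments[OF M] finite_assignments[OF mpkhd_instance_unit_split[OF M]]
      by simp_all
  qed (auto simp: assignments_unit_split)
  also have "\<dots> = (\<Sum>b\<in>?B. g b)" by (intro sum.cong refl fib)
  finally show ?thesis .
qed

text \<open>Spread the selection probabilities of the policy evenly over the copies of each type.\<close>

lemma clairvoyant_lp_solution:
  assumes M: "mpkhd_instance M" and \<pi>: "clairvoyant_policy M \<pi>"
  obtains y where "lp_feasible (unit_split M) y" "lp_value (unit_split M) y = expected_profit M \<pi>"
proof -
  define U where "U = unit_split M"
  \<comment> \<open>The overall probability of selecting \<open>f\<close> in round \<open>t\<close>;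
    the shift to \<open>t - 1\<close> is there because \<open>select_prob\<close> counts completed
    rounds.\<close>
  define z where "z = (\<lambda>f t. measure_pmf.expectation (arrivals M) (\<lambda>a. select_prob M \<pi> a (t - 1) f))"
  define y where "y = (\<lambda>f t. z (original f) t / real (capacity M (fst (original f))))"
  note fin = finite_set_pmf_arrivals[OF M]
  note adm = clairvoyant_admissible[OF \<pi>]
  have z0: "0 \<le> z f t" for f t
    unfolding z_def by (simp add: integral_nonneg_AE select_prob_nonneg)
  have "(\<Sum>f\<in>assignments_on U j. y f t) \<le> pmf (arrival U t) j" if t: "t \<in> rounds M" for t j
  proof -
    have t': "t - 1 < horizon M" "Suc (t - 1) = t" using t by (auto simp: rounds_def)
    have "(\<Sum>f\<in>assignments_on U j. y f t) = (\<Sum>f\<in>assignments_on M j. z f t)"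
      using sum_unit_split[OF M, where P = "\<lambda>f. fst (snd f) = j" and g = "\<lambda>f. z f t"]
      by (simp add: U_def y_def assignments_on_def) (simp add: original_def)
    also have "\<dots> = measure_pmf.expectation (arrivals M)
        (\<lambda>a. \<Sum>f\<in>assignments_on M j. select_prob M \<pi> a (t - 1) f)"
      by (simp add: z_def expectation_sum_pmf[OF fin])
    also have "\<dots> \<le> measure_pmf.expectation (arrivals M) (\<lambda>a. of_bool (a t = j))"
      using sum_select_prob_le[OF M \<pi> t'(1), unfolded t'(2)]
      by (intro expectation_mono_pmf[OF fin])
    finally show ?thesis using expectation_arrival[OF t] by (simp add: U_def unit_split_simps)
  qed
  moreover have "(\<Sum>t\<in>rounds U. \<Sum>f\<in>assignments_off U i. y f t * accept U f t) \<le> 1"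
    if i: "i \<in> offline U" for i
  proof -
    obtain i' c where ic: "i = (i', c)" "i' \<in> offline M" "c \<in> {1..capacity M i'}"
      using i by (auto simp: U_def unit_split_def)
    then have cap: "0 < capacity M i'" using M by (simp add: mpkhd_instance_def)
    have off: "assignments_off U i = (\<lambda>f. ((i', c), snd f)) ` assignments_off M i'"
      using ic by (auto simp: U_def assignments_off_def assignments_unit_split original_def image_iff)
    have inj: "inj_on (\<lambda>f. ((i', c), snd f)) (assignments_off M i')"
      by (auto simp: inj_on_def assignments_off_def)
    have "(\<Sum>f\<in>assignments_off U i. y f t * accept U f t) =
        (\<Sum>f\<in>assignments_off M i'. z f t * accept M f t) / real (capacity M i')" for t
      unfolding off sum.reindex[OF inj] sum_divide_distrib
      by (intro sum.cong refl)
        (auto simp: U_def y_def unit_split_simps original_def assignments_off_def)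
    then have "(\<Sum>t\<in>rounds U. \<Sum>f\<in>assignments_off U i. y f t * accept U f t) =
        (\<Sum>t<horizon M. \<Sum>f\<in>assignments_off M i'. z f (Suc t) * accept M f (Suc t)) / real (capacity M i')"
      by (simp add: U_def unit_split_simps sum_rounds sum_divide_distrib)
    \<comment> \<open>The numerator is the expected total consumption of \<open>i'\<close>, which is
      at most its capacity in every run; each copy carries an equal share, hence at most 1.\<close>
    also have "(\<Sum>t<horizon M. \<Sum>f\<in>assignments_off M i'. z f (Suc t) * accept M f (Suc t)) =
        measure_pmf.expectation (arrivals M) (\<lambda>a.
          measure_pmf.expectation (run M \<pi> a (horizon M)) (\<lambda>h. real (used h i')))"
      by (simp add: expectation_used[OF M adm] expectation_sum_pmf[OF fin] z_def)
    also have "\<dots> \<le> measure_pmf.expectation (arrivals M) (\<lambda>a.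
          measure_pmf.expectation (run M \<pi> a (horizon M)) (\<lambda>h. real (capacity M i')))"
      using used_le_capacity[OF adm]
      by (intro expectation_mono_pmf fin finite_set_pmf_run[OF M adm]) auto
    finally show ?thesis using cap by (simp add: divide_right_mono)
  qed
  moreover have "0 \<le> y f t" for f t
    by (simp add: y_def z0)
  ultimately have "lp_feasible U y"
    by (simp add: lp_feasible_def U_def unit_split_simps)
  moreover have "lp_value U y = expected_profit M \<pi>"
  proof -
    have "lp_value U y = (\<Sum>t\<in>rounds M. \<Sum>f\<in>assignments M. z f t * accept M f t * profit M f t)"
      unfolding lp_value_def
      using sum_unit_split[OF M, where P = "\<lambda>_. True" and g = "\<lambda>f. z f t * accept M f t * profit M f t" for t]
      by (simp add: U_def y_def unit_split_simps)
    then show ?thesis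
      by (simp add: expected_profit_eq[OF M adm] sum_rounds z_def)
  qed
  ultimately show thesis using that unfolding U_def by blast
qed

lemma opt_off_le_lp_value:
  assumes M: "mpkhd_instance M" and x: "lp_optimal (unit_split M) x"
  shows "opt_off M \<le> lp_value (unit_split M) x"
  unfolding opt_off_def
proof (rule cSup_least)
  \<comment> \<open>Always rejecting shows that the supremum is over a nonempty set.\<close>
  have "clairvoyant_policy M (\<lambda>_ _. return_pmf None)"
    by (simp add: clairvoyant_policy_def)
  then show "{expected_profit M \<pi> |\<pi>. clairvoyant_policy M \<pi>} \<noteq> {}" by blast
next
  fix r assume "r \<in> {expected_profit M \<pi> |\<pi>. clairvoyant_policy M \<pi>}"
  then obtain \<pi> where "r = expected_profit M \<pi>" "clairvoyant_policy M \<pi>" by blast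
  then show "r \<le> lp_value (unit_split M) x"
    using clairvoyant_lp_solution[OF M] x unfolding lp_optimal_def by metis
qed

section \<open>The profit of ATT\<close>

lemma pmf_att:
  "pmf (att M \<gamma> x a h) (Some f) = of_bool (available M h (fst f)) *
     pmf (att_sample M \<gamma> x (Suc (length h)) (a (Suc (length h)))) (Some f)"
proof -
  have "(\<lambda>s. case s of None \<Rightarrow> None | Some f \<Rightarrow> if available M h (fst f) then Some f else None) -`
      {Some f} = (if available M h (fst f) then {Some f} else {})"
    by (auto split: option.splits if_splits)
  then show ?thesis by (simp add: att_def pmf_map measure_pmf_single)
qed

text \<open>ATT is an online policy: its history after \<open>t\<close> rounds cannot depend on
  later arrivals. This makes availability independent of the next arrival.\<close>

lemma run_att_cong:
  assumes "\<And>s. s \<in> {1..t} \<Longrightarrow> a s = b s"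
  shows "run M (att M \<gamma> x) a t = run M (att M \<gamma> x) b t"
  using assms
proof (induction t)
  case (Suc t)
  then have "att M \<gamma> x a h = att M \<gamma> x b h" if "length h = t" for h
    using that by (simp add: att_def)
  then show ?case
    using Suc length_run[of _ M "att M \<gamma> x" b t] by (auto intro!: bind_pmf_cong)
qed simp

section \<open>Exact selection probabilities on a unit-capacity instance\<close>

context
  fixes M :: "('i, 'j) mpkhd" and \<gamma> :: real and x :: "('i, 'j) lp_vector"
  assumes M: "mpkhd_instance M" and unit: "capacity M = (\<lambda>_. 1)"
    and \<gamma>: "0 \<le> \<gamma>" "\<gamma> \<le> 1 / 2" and x: "lp_feasible M x"
begin

lemma admissible_att:
  assumes a: "a \<in> set_pmf (arrivals M)"
  shows "admissible M (att M \<gamma> x) a"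
  unfolding admissible_def
proof (intro allI impI)
  fix h :: "('i, 'j) history" and f
  assume h: "length h < horizon M" and f: "Some f \<in> set_pmf (att M \<gamma> x a h)"
  have t: "Suc (length h) \<in> rounds M" using h by (simp add: rounds_def)
  show "f \<in> assignments M \<and> available M h (fst f)"
    using f pmf_att_sample[OF M x \<gamma> t arrivals_in_online[OF M a t], of f]
    by (auto simp: set_pmf_iff pmf_att assignments_on_def split: if_splits)
qed

lemma expectation_available:
  assumes a: "a \<in> set_pmf (arrivals M)" and t: "t < horizon M"
  shows "measure_pmf.expectation (run M (att M \<gamma> x) a t) (\<lambda>h. of_bool (available M h i)) =
    1 - (\<Sum>s<t. \<Sum>f\<in>assignments_off M i. select_prob M (att M \<gamma> x) a s f * accept M f (Suc s))"
proof -
  let ?R = "run M (att M \<gamma> x) a t"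
  have fin: "finite (set_pmf ?R)"
    using finite_set_pmf_run[OF M admissible_att[OF a]] t by simp
  \<comment> \<open>With unit capacity \<open>used h i\<close> is 0 or 1, so the availability
    probability is one minus the expected consumption.\<close>
  have "of_bool (available M h i) = 1 - real (used h i)" if "h \<in> set_pmf ?R" for h
    using used_le_capacity[OF admissible_att[OF a] _ that, of i] t
    by (auto simp: available_def unit of_bool_def)
  then have "measure_pmf.expectation ?R (\<lambda>h. of_bool (available M h i)) =
      measure_pmf.expectation ?R (\<lambda>h. 1 - real (used h i))"
    by (rule expectation_cong_pmf)
  also have "\<dots> = 1 - measure_pmf.expectation ?R (\<lambda>h. real (used h i))"
    using fin by (subst Bochner_Integration.integral_diff) (auto intro: integrable_measure_pmf_finite)
  finally show ?thesis using expectation_used[OF M admissible_att[OF a]] t by simp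
qed

text \<open>The availability probability and the arrival probability cancel the two denominators of
  the sampling weight. The first is positive by \<open>att_beta_ge\<close>; if the second vanishes,
  the arrival constraint forces \<open>x f t\<close> to be 0 as well.\<close>

lemma att_prob_mult:
  assumes t: "t \<in> rounds M" and f: "f \<in> assignments M"
  shows "att_beta M \<gamma> x (fst f) t *
    (att_prob M \<gamma> x t (fst (snd f)) f * pmf (arrival M t) (fst (snd f))) = \<gamma> * x f t"
proof -
  let ?j = "fst (snd f)"
  have j: "?j \<in> online M" and i: "fst f \<in> offline M"
    using f M by (auto simp: assignments_def mpkhd_instance_def)
  have "att_beta M \<gamma> x (fst f) t \<noteq> 0"
    using att_beta_ge[OF M x \<gamma>(1) t i] \<gamma> by auto
  moreover have "x f t = 0" if "pmf (arrival M t) ?j = 0"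
  proof -
    have "x f t \<le> (\<Sum>f\<in>assignments_on M ?j. x f t)"
      using x t f assignments_on_finite[OF M]
      by (intro member_le_sum) (auto simp: assignments_on_def lp_feasible_def)
    also have "\<dots> \<le> 0" using x t j that by (fastforce simp: lp_feasible_def)
    finally show ?thesis using x t f by (auto simp: lp_feasible_def intro: antisym)
  qed
  ultimately show ?thesis by (auto simp: att_prob_def)
qed

text \<open>
  The choice of \<open>\<beta>\<^sub>i\<^sub>,\<^sub>t\<close> is exactly the probability that \<open>i\<close> is available in round \<open>t\<close>, so the
  factor \<open>\<gamma> / \<beta>\<^sub>i\<^sub>,\<^sub>t\<close> makes the unconditional selection probability \<open>\<gamma> x\<^sub>f\<^sub>,\<^sub>t\<close>.
\<close>

lemma expectation_select_prob_att:
  assumes "t < horizon M" and "f \<in> assignments M"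
  shows "measure_pmf.expectation (arrivals M) (\<lambda>a. select_prob M (att M \<gamma> x) a t f) =
    \<gamma> * x f (Suc t)"
  using assms
proof (induction t arbitrary: f rule: less_induct)
  case (less t)
  define i where "i = fst f"
  define G where "G = (\<lambda>a. measure_pmf.expectation (run M (att M \<gamma> x) a t)
    (\<lambda>h. of_bool (available M h i) :: real))"
  define H where "H = (\<lambda>j. if f \<in> assignments_on M j then att_prob M \<gamma> x (Suc t) j f else 0)"
  note fin = finite_set_pmf_arrivals[OF M]
  have t: "Suc t \<in> rounds M" using less.prems by (simp add: rounds_def)
  \<comment> \<open>Given the arrivals, \<open>f\<close> is selected when its offline type is
    available and the fresh sample equals \<open>f\<close>: \<open>G\<close> depends on past
    arrivals, \<open>H\<close> on the current one.\<close>
  have sel: "select_prob M (att M \<gamma> x) a t f = G a * H (a (Suc t))"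
    if a: "a \<in> set_pmf (arrivals M)" for a
  proof -
    have "select_prob M (att M \<gamma> x) a t f = measure_pmf.expectation (run M (att M \<gamma> x) a t)
        (\<lambda>h. of_bool (available M h i) * H (a (Suc t)))"
      unfolding select_prob_def
      by (rule expectation_cong_pmf)
        (simp add: pmf_att length_run i_def H_def pmf_att_sample[OF M x \<gamma> t arrivals_in_online[OF M a t]])
    then show ?thesis by (simp add: G_def)
  qed
  have "measure_pmf.expectation (arrivals M) (\<lambda>a. select_prob M (att M \<gamma> x) a t f) =
      measure_pmf.expectation (arrivals M) (\<lambda>a. G a * H (a (Suc t)))"
    by (rule expectation_cong_pmf) (rule sel)
  also have "\<dots> = measure_pmf.expectation (arrivals M) G *
      measure_pmf.expectation (arrival M (Suc t)) H"
    unfolding arrivals_def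
  proof (rule expectation_Pi_pmf_mult)
    show "finite (set_pmf (arrival M s))" if "s \<in> rounds M" for s
      using M that by (rule finite_set_pmf_arrival)
    show "G (a(Suc t := j)) = G a" for a j
      unfolding G_def by (subst run_att_cong[of t "a(Suc t := j)" a]) auto
  qed (use t in \<open>auto simp: rounds_def\<close>)
  also have "measure_pmf.expectation (arrivals M) G = att_beta M \<gamma> x i (Suc t)"
  proof -
    have "measure_pmf.expectation (arrivals M) G = measure_pmf.expectation (arrivals M)
        (\<lambda>a. 1 - (\<Sum>s<t. \<Sum>f\<in>assignments_off M i.
          select_prob M (att M \<gamma> x) a s f * accept M f (Suc s)))"
      unfolding G_def by (rule expectation_cong_pmf) (simp add: expectation_available less.prems)
    also have "\<dots> = 1 - (\<Sum>s<t. \<Sum>f\<in>assignments_off M i.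
        measure_pmf.expectation (arrivals M) (\<lambda>a. select_prob M (att M \<gamma> x) a s f) * accept M f (Suc s))"
      using fin by (subst Bochner_Integration.integral_diff)
        (auto intro: integrable_measure_pmf_finite simp: expectation_sum_pmf)
    \<comment> \<open>The induction hypothesis, for all assignments of \<open>i\<close> in all
      earlier rounds, turns the expected consumption into the sum defining
      \<open>att_beta\<close>.\<close>
    also have "\<dots> = 1 - (\<Sum>s<t. \<Sum>f\<in>assignments_off M i. \<gamma> * x f (Suc s) * accept M f (Suc s))"
      using less.IH less.prems by (simp add: assignments_off_def)
    also have "\<dots> = att_beta M \<gamma> x i (Suc t)"
      by (simp add: att_beta_def atLeastLessThanSuc_atLeastAtMost sum.atLeast1_atMost_eq
          sum_distrib_left mult.assoc)
    finally show ?thesis .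
  qed
  also have "measure_pmf.expectation (arrival M (Suc t)) H =
      att_prob M \<gamma> x (Suc t) (fst (snd f)) f * pmf (arrival M (Suc t)) (fst (snd f))"
    using less.prems by (subst integral_measure_pmf_real[of "{fst (snd f)}"])
      (auto simp: H_def assignments_on_def split: if_splits)
  finally show ?case using att_prob_mult[OF t less.prems(2)] by (simp add: i_def)
qed

lemma expected_profit_att: "expected_profit M (att M \<gamma> x) = \<gamma> * lp_value M x"
proof -
  have "expected_profit M (att M \<gamma> x) = (\<Sum>t<horizon M. \<Sum>f\<in>assignments M.
      \<gamma> * x f (Suc t) * accept M f (Suc t) * profit M f (Suc t))"
    by (simp add: expected_profit_eq[OF M admissible_att] expectation_select_prob_att)
  then show ?thesis
    by (simp add: lp_value_def sum_rounds sum_distrib_left mult.assoc)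
qed

end

theorem theorem2p1:
  fixes M :: "('i, 'j) mpkhd"
    and \<gamma> :: real
    and x :: "('i \<times> nat, 'j) lp_vector"
  assumes "mpkhd_instance M"
    and "0 \<le> \<gamma>" and "\<gamma> \<le> 1 / 2"
    and "lp_optimal (unit_split M) x"
  shows "expected_profit (unit_split M) (att (unit_split M) \<gamma> x) \<ge> \<gamma> * opt_off M"
proof -
  have "expected_profit (unit_split M) (att (unit_split M) \<gamma> x) = \<gamma> * lp_value (unit_split M) x"
    using assms by (intro expected_profit_att mpkhd_instance_unit_split)
      (auto simp: unit_split_simps lp_optimal_def)
  then show ?thesis
    using opt_off_le_lp_value[OF assms(1,4)] assms(2) by (simp add: mult_left_mono)
qed

end
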